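(* Let $G$ be a finite graph of maximum degree $\Delta$ such that for every vertex $u$, the subgraph $G[N(u)]$ induced by its neighbourhood has average degree at most $d$, where $d\le \frac{\Delta}{6}-1$. Write $\rho \coloneqq \Delta/(d+1)$ and let $\ell \ge (d+1)(\ln \rho)^3$. Then for every list-assignment $L\colon V(G)\to 2^{\mathbb{N}}$ with \[|L(v)| \ge \left(1+\frac{2}{\ln \rho}\right) \frac{\deg(v)}{W\left(\frac{\deg(v)}{\ell}\right)}\] for every vertex $v\in V(G)$, the following holds: for every $v \in V(G)$, if $\boldsymbol{\sigma}$ is a uniformly random proper $L$-colouring of $G\setminus v$, then $\mathbb{E}[\ell_{\boldsymbol{\sigma}}(v)] \ge \ell$.
   Context: A list-assignment of $G$ is a map $L\colon V(G)\to 2^{\mathbb{N}}$; a proper $L$-colouring is a map $c$ with $c(v)\in L(v)$ for all $v$ and $c(u)\ne c(v)$ for all edges $uv$. For a subgraph $H$ of $G$, a proper $L$-colouring $\sigma$ of $H$ and $v\in V(G)$, $L_\sigma(v)\coloneqq L(v)\setminus\sigma(N_G(v)\cap V(H))$ and $\ell_\sigma(v)\coloneqq|L_\sigma(v)|$. $W$ denotes the Lambert $W$ function, the inverse of $z\mapsto z\mathrm{e}^z$ on $[0,\infty)$. *)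

theory Defs
  imports "HOL-Probability.Probability"
begin

definition simple_graph :: "'v set \<Rightarrow> ('v \<Rightarrow> 'v \<Rightarrow> bool) \<Rightarrow> bool" where
  "simple_graph V E \<longleftrightarrow>
     symp E \<and> irreflp E \<and> (\<forall>x y. E x y \<longrightarrow> x \<in> V \<and> y \<in> V)"

definition nbhd :: "('v \<Rightarrow> 'v \<Rightarrow> bool) \<Rightarrow> 'v \<Rightarrow> 'v set" where
  "nbhd E u = {w. E u w}"

definition vertex_degree :: "('v \<Rightarrow> 'v \<Rightarrow> bool) \<Rightarrow> 'v \<Rightarrow> nat" where
  "vertex_degree E u = card (nbhd E u)"

definition max_degree :: "'v set \<Rightarrow> ('v \<Rightarrow> 'v \<Rightarrow> bool) \<Rightarrow> nat" where
  "max_degree V E = Max (vertex_degree E ` V)"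

(* The null graph gets average degree 0. *)
definition average_degree :: "'v set \<Rightarrow> ('v \<Rightarrow> 'v \<Rightarrow> bool) \<Rightarrow> real" where
  "average_degree V E = (\<Sum>u\<in>V. real (vertex_degree E u)) / real (card V)"

(* Edge relation of the subgraph induced by U. *)
definition induced :: "('v \<Rightarrow> 'v \<Rightarrow> bool) \<Rightarrow> 'v set \<Rightarrow> 'v \<Rightarrow> 'v \<Rightarrow> bool" where
  "induced E U = (\<lambda>x y. x \<in> U \<and> y \<in> U \<and> E x y)"

(* Colourings are extensional (undefined off V), so each one is represented by exactly
   one function; this matters for the uniform distribution. *)
definition proper_colourings ::
    "'v set \<Rightarrow> ('v \<Rightarrow> 'v \<Rightarrow> bool) \<Rightarrow> ('v \<Rightarrow> nat set) \<Rightarrow> ('v \<Rightarrow> nat) set" where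
  "proper_colourings V E L = {c \<in> Pi\<^sub>E V L. \<forall>x y. E x y \<longrightarrow> c x \<noteq> c y}"

(* The list L_sigma(v) for a colouring sigma of a subgraph of (V, E) with vertex set U. *)
definition residual_list ::
    "('v \<Rightarrow> 'v \<Rightarrow> bool) \<Rightarrow> ('v \<Rightarrow> nat set) \<Rightarrow> 'v set \<Rightarrow> ('v \<Rightarrow> nat) \<Rightarrow> 'v \<Rightarrow> nat set" where
  "residual_list E L U \<sigma> v = L v - \<sigma> ` (nbhd E v \<inter> U)"

definition Lambert_W :: "real \<Rightarrow> real" where
  "Lambert_W = the_inv_into {0..} (\<lambda>z. z * exp z)"

(* The quotient x / W(x/l) has a removable singularity at x = 0, where its limit is l
   (lemma div_Lambert_W_tendsto); HOL's 0 / 0 = 0 would give the wrong value there. *)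
definition div_Lambert_W :: "real \<Rightarrow> real \<Rightarrow> real" where
  "div_Lambert_W x l = (if x = 0 then l else x / Lambert_W (x / l))"

lemma inj_on_mult_exp: "inj_on (\<lambda>z::real. z * exp z) {0..}"
proof (rule linorder_inj_onI)
  fix x y :: real
  assume "x < y" "x \<in> {0..}" "y \<in> {0..}"
  then have "x * exp x < y * exp y"
    by (intro mult_strict_mono) auto
  then show "x * exp x \<noteq> y * exp y" by simp
qed auto

lemma image_mult_exp: "(\<lambda>z::real. z * exp z) ` {0..} = {0..}"
proof
  show "{0..} \<subseteq> (\<lambda>z::real. z * exp z) ` {0..}"
  proof
    fix x :: real
    assume "x \<in> {0..}"
    then have x: "0 \<le> x" by simp
    have "\<exists>z\<ge>0. z \<le> x \<and> z * exp z = x"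
    proof (rule IVT)
      show "x \<le> x * exp x"
        using x mult_left_mono[of 1 "exp x" x] by simp
    qed (use x in auto)
    then show "x \<in> (\<lambda>z::real. z * exp z) ` {0..}" by force
  qed
qed auto

lemma Lambert_W_nonneg: "0 \<le> x \<Longrightarrow> 0 \<le> Lambert_W x"
  using the_inv_into_into[OF inj_on_mult_exp, of x "{0..}"]
  by (simp add: Lambert_W_def image_mult_exp)

lemma Lambert_W_times_exp: "0 \<le> x \<Longrightarrow> Lambert_W x * exp (Lambert_W x) = x"
  using f_the_inv_into_f[OF inj_on_mult_exp, of x]
  by (simp add: Lambert_W_def image_mult_exp)

lemma Lambert_W_le: "0 \<le> x \<Longrightarrow> Lambert_W x \<le> x"
  using mult_left_mono[of 1 "exp (Lambert_W x)" "Lambert_W x"]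
  by (simp add: Lambert_W_nonneg Lambert_W_times_exp)

lemma div_Lambert_W_eq:
  assumes "0 \<le> x" "0 < l"
  shows "div_Lambert_W x l = l * exp (Lambert_W (x / l))"
proof (cases "x = 0")
  case True
  have "Lambert_W 0 = 0"
    using Lambert_W_le[of 0] Lambert_W_nonneg[of 0] by simp
  with True show ?thesis by (simp add: div_Lambert_W_def)
next
  case False
  have eq: "Lambert_W (x / l) * exp (Lambert_W (x / l)) = x / l"
    using assms by (intro Lambert_W_times_exp) simp
  then have "Lambert_W (x / l) \<noteq> 0"
    using False assms by auto
  with False eq assms show ?thesis
    by (simp add: div_Lambert_W_def field_simps)
qed

lemma div_Lambert_W_tendsto:
  assumes "0 < l"
  shows "((\<lambda>x. x / Lambert_W (x / l)) \<longlongrightarrow> l) (at_right 0)"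
proof -
  have pos: "eventually (\<lambda>x::real. 0 < x) (at_right 0)"
    by (simp add: eventually_at_right_less)
  have lim: "((\<lambda>x. x / l) \<longlongrightarrow> 0) (at_right 0)"
    using tendsto_divide[OF tendsto_ident_at tendsto_const, of l 0 "{0<..}"] assms by simp
  have "((\<lambda>x. Lambert_W (x / l)) \<longlongrightarrow> 0) (at_right 0)"
  proof (rule tendsto_sandwich[OF _ _ tendsto_const lim])
    show "eventually (\<lambda>x. 0 \<le> Lambert_W (x / l)) (at_right 0)"
      using pos by (rule eventually_mono) (simp add: Lambert_W_nonneg assms less_imp_le)
    show "eventually (\<lambda>x. Lambert_W (x / l) \<le> x / l) (at_right 0)"
      using pos by (rule eventually_mono) (rule Lambert_W_le, simp add: assms less_imp_le)
  qed
  then have "((\<lambda>x. l * exp (Lambert_W (x / l))) \<longlongrightarrow> l * exp 0) (at_right 0)"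
    by (intro tendsto_intros)
  moreover have "eventually
      (\<lambda>x. l * exp (Lambert_W (x / l)) = x / Lambert_W (x / l)) (at_right 0)"
  proof (rule eventually_mono[OF pos])
    fix x :: real
    assume "0 < x"
    then show "l * exp (Lambert_W (x / l)) = x / Lambert_W (x / l)"
      using div_Lambert_W_eq[of x l] assms by (simp add: div_Lambert_W_def)
  qed
  ultimately show ?thesis
    using Lim_transform_eventually[of _ "l * exp 0"] by simp
qed

end

theory Submission imports Defs begin

text \<open>By induction on \<open>U \<subseteq> V\<close>, adding a vertex multiplies the number of colourings by at least
  \<open>\<l>\<close>; this ratio is the expected number of colours left for the new vertex \<open>v\<close>. Given the colouring
  outside \<open>N(v)\<close>, a neighbour \<open>u\<close> of degree \<open>d\<^sub>u\<close> in \<open>G[N(v)]\<close> with \<open>m\<^sub>u\<close> colours left takes a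
  given colour with probability at most \<open>1 / (m\<^sub>u - d\<^sub>u)\<close>, whatever the other neighbours do. So a colour
  is avoided by all of \<open>N(v)\<close> with probability at least a product over \<open>N(v)\<close>, and linearising that
  product at \<open>a = W(deg(v) / \<l>)\<close> makes the loss proportional to the sum of the
  \<open>(d\<^sub>u + 1) / m\<^sub>u\<close>. By the induction hypothesis \<open>1 / m\<^sub>u\<close> has mean at most \<open>1 / \<l>\<close>,
  so local sparsity bounds the loss by \<open>deg(v) (d + 1) / \<l>\<close> up to a factor \<open>1 + a\<close>. Unlike the average
  degree, the number of edges in a neighbourhood is monotone in \<open>U\<close>, so degrees and sparsity
  are measured in the whole graph throughout.\<close>

section \<open>Elementary inequalities and a switching count\<close>

lemma Lambert_W_le_of_le:
  assumes "0 \<le> x" "0 \<le> b" "x \<le> b * exp b"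
  shows "Lambert_W x \<le> b"
proof (rule ccontr)
  assume "\<not> Lambert_W x \<le> b"
  then have "b * exp b < Lambert_W x * exp (Lambert_W x)"
    using assms by (intro mult_strict_mono) auto
  then show False
    using assms Lambert_W_times_exp[of x] by simp
qed

text \<open>The reciprocal of \<open>1 + t \<le> exp t\<close> at \<open>t = 1 / (m - 1)\<close>. It
  turns a product of avoidance probabilities into the exponential of a sum.\<close>

lemma one_minus_inverse_ge_exp:
  fixes m :: real
  assumes "1 < m"
  shows "exp (- (1 / (m - 1))) \<le> 1 - 1 / m"
proof -
  have "1 + 1 / (m - 1) \<le> exp (1 / (m - 1))"
    by (rule exp_ge_add_one_self)
  then have "inverse (exp (1 / (m - 1))) \<le> inverse (1 + 1 / (m - 1))"
    using assms by (intro le_imp_inverse_le) (auto intro: add_pos_nonneg)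
  also have "\<dots> = 1 - 1 / m"
    using assms by (simp add: field_simps)
  finally show ?thesis by (simp add: exp_minus)
qed

text \<open>Double counting: each \<open>\<sigma>\<close> with \<open>\<sigma> u = c\<close> has at
  least \<open>m\<close> recolourings in \<open>T\<close>, and it can be recovered from
  \<open>\<sigma>(u := b)\<close> because its colour at \<open>u\<close> was \<open>c\<close>. For
  positive \<open>m\<close>, colour \<open>c\<close> thus appears at \<open>u\<close> with
  probability at most \<open>1 / m\<close>.\<close>

lemma card_value_le_switching:
  fixes m :: real
  assumes "finite T"
    and "\<And>\<sigma>. \<sigma> \<in> T \<Longrightarrow> \<sigma> u = c \<Longrightarrow>
           \<exists>A. finite A \<and> m \<le> real (card A) \<and> (\<forall>b\<in>A. \<sigma>(u := b) \<in> T)"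
  shows "m * real (card {\<sigma>\<in>T. \<sigma> u = c}) \<le> real (card T)"
proof -
  let ?S = "{\<sigma>\<in>T. \<sigma> u = c}"
  have "\<forall>\<sigma>\<in>?S. \<exists>A. finite A \<and> m \<le> real (card A) \<and> (\<forall>b\<in>A. \<sigma>(u := b) \<in> T)"
    using assms(2) by blast
  then obtain A where A: "\<And>\<sigma>. \<sigma> \<in> ?S \<Longrightarrow> finite (A \<sigma>)"
      "\<And>\<sigma>. \<sigma> \<in> ?S \<Longrightarrow> m \<le> real (card (A \<sigma>))"
      "\<And>\<sigma> b. \<sigma> \<in> ?S \<Longrightarrow> b \<in> A \<sigma> \<Longrightarrow> \<sigma>(u := b) \<in> T"
    by (metis (no_types, lifting) bchoice)
  have inj: "inj_on (\<lambda>(\<sigma>, b). \<sigma>(u := b)) (Sigma ?S A)"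
  proof (rule inj_onI, clarsimp)
    fix \<sigma> b \<tau> b'
    assume eq: "\<sigma>(u := b) = \<tau>(u := b')" and "\<tau> u = \<sigma> u"
    have "\<sigma> x = \<tau> x" for x
      using fun_cong[OF eq, of x] \<open>\<tau> u = \<sigma> u\<close> by (cases "x = u") auto
    moreover have "b = b'"
      using fun_cong[OF eq, of u] by simp
    ultimately show "\<sigma> = \<tau> \<and> b = b'" by auto
  qed
  have "m * real (card ?S) = (\<Sum>\<sigma>\<in>?S. m)" by simp
  also have "\<dots> \<le> (\<Sum>\<sigma>\<in>?S. real (card (A \<sigma>)))"
    by (intro sum_mono A(2))
  also have "\<dots> = real (card (Sigma ?S A))"
    using assms(1) A(1) by (subst card_SigmaI) auto
  also have "\<dots> = real (card ((\<lambda>(\<sigma>, b). \<sigma>(u := b)) ` Sigma ?S A))"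
    by (simp add: card_image[OF inj])
  also have "\<dots> \<le> real (card T)"
    using A(3) assms(1) by (intro of_nat_mono card_mono) auto
  finally show ?thesis .
qed

section \<open>Colourings of induced subgraphs and their extension by one vertex\<close>

locale list_coloured_graph =
  fixes V :: "'v set" and E :: "'v \<Rightarrow> 'v \<Rightarrow> bool" and L :: "'v \<Rightarrow> nat set"
  assumes finite_V: "finite V"
    and graph: "simple_graph V E"
    and finite_L: "\<And>v. v \<in> V \<Longrightarrow> finite (L v)"
begin

abbreviation colourings :: "'v set \<Rightarrow> ('v \<Rightarrow> nat) set" where
  "colourings U \<equiv> proper_colourings U (induced E U) L"

abbreviation residual_size :: "'v set \<Rightarrow> ('v \<Rightarrow> nat) \<Rightarrow> 'v \<Rightarrow> nat" where
  "residual_size U \<sigma> u \<equiv> card (residual_list E L U \<sigma> u)"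

lemma edge_sym: "E x y \<Longrightarrow> E y x"
  using graph by (auto simp: simple_graph_def dest: sympD)

lemma no_loop: "\<not> E x x"
  using graph by (auto simp: simple_graph_def dest: irreflpD)

lemma nbhd_subset: "nbhd E u \<subseteq> V"
  using graph by (auto simp: simple_graph_def nbhd_def)

lemma finite_nbhd: "finite (nbhd E u)"
  using nbhd_subset finite_V by (rule finite_subset)

lemma colourings_iff:
  "\<sigma> \<in> colourings U \<longleftrightarrow>
     \<sigma> \<in> Pi\<^sub>E U L \<and> (\<forall>x\<in>U. \<forall>y\<in>U. E x y \<longrightarrow> \<sigma> x \<noteq> \<sigma> y)"
  by (auto simp: proper_colourings_def induced_def)

lemma finite_colourings: "U \<subseteq> V \<Longrightarrow> finite (colourings U)"
  using finite_V finite_L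
  by (auto simp: proper_colourings_def intro!: finite_subset[OF _ finite_PiE[of U L]]
        dest: finite_subset)

lemma finite_residual_list: "u \<in> V \<Longrightarrow> finite (residual_list E L U \<sigma> u)"
  using finite_L by (simp add: residual_list_def)

lemma residual_list_cong:
  "(\<And>x. x \<in> U \<Longrightarrow> \<sigma> x = \<tau> x) \<Longrightarrow> residual_list E L U \<sigma> u = residual_list E L U \<tau> u"
  by (auto simp: residual_list_def image_iff)

lemma recolour:
  assumes "\<sigma> \<in> colourings U" "u \<in> U" "c \<in> residual_list E L (U - {u}) \<sigma> u"
  shows "\<sigma>(u := c) \<in> colourings U"
  using assms edge_sym no_loop
  by (auto simp: colourings_iff residual_list_def nbhd_def PiE_def Pi_def extensional_def)

lemma colour_in_residual_list:
  assumes "\<sigma> \<in> colourings U" "u \<in> U"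
  shows "\<sigma> u \<in> residual_list E L (U - {u}) \<sigma> u"
  using assms by (auto simp: colourings_iff residual_list_def nbhd_def)

text \<open>The inverse forgets \<open>u\<close> and records its colour; as colourings are
  extensional, restricting to \<open>U - {u}\<close> loses nothing else.\<close>

lemma bij_betw_extend_colouring:
  assumes "u \<in> U"
  shows "bij_betw (\<lambda>(\<tau>, c). \<tau>(u := c))
           (SIGMA \<tau>:colourings (U - {u}). residual_list E L (U - {u}) \<tau> u) (colourings U)"
proof (rule bij_betw_byWitness[where f' = "\<lambda>\<sigma>. (restrict \<sigma> (U - {u}), \<sigma> u)"])
  let ?S = "SIGMA \<tau>:colourings (U - {u}). residual_list E L (U - {u}) \<tau> u"
  show "\<forall>p\<in>?S. (\<lambda>\<sigma>. (restrict \<sigma> (U - {u}), \<sigma> u)) ((\<lambda>(\<tau>, c). \<tau>(u := c)) p) = p"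
    by (auto simp: colourings_iff fun_eq_iff PiE_def extensional_def)
  show "\<forall>\<sigma>\<in>colourings U. (\<lambda>(\<tau>, c). \<tau>(u := c)) (restrict \<sigma> (U - {u}), \<sigma> u) = \<sigma>"
    using assms by (auto simp: colourings_iff fun_eq_iff PiE_def extensional_def)
  show "(\<lambda>(\<tau>, c). \<tau>(u := c)) ` ?S \<subseteq> colourings U"
    using assms edge_sym no_loop
    by (auto simp: colourings_iff residual_list_def nbhd_def PiE_def Pi_def extensional_def)
  show "(\<lambda>\<sigma>. (restrict \<sigma> (U - {u}), \<sigma> u)) ` colourings U \<subseteq> ?S"
  proof clarify
    fix \<sigma> assume \<sigma>: "\<sigma> \<in> colourings U"
    have "residual_list E L (U - {u}) (restrict \<sigma> (U - {u})) u = residual_list E L (U - {u}) \<sigma> u"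
      by (rule residual_list_cong) simp
    then show "restrict \<sigma> (U - {u}) \<in> colourings (U - {u}) \<and>
        \<sigma> u \<in> residual_list E L (U - {u}) (restrict \<sigma> (U - {u})) u"
      using colour_in_residual_list[OF \<sigma> assms] \<sigma> by (auto simp: colourings_iff)
  qed
qed

lemma sum_colourings_extend:
  fixes g :: "('v \<Rightarrow> nat) \<Rightarrow> real"
  assumes "U \<subseteq> V" "u \<in> U" and g: "\<And>\<tau> c. g (\<tau>(u := c)) = g \<tau>"
  shows "(\<Sum>\<sigma>\<in>colourings U. g \<sigma>) =
    (\<Sum>\<tau>\<in>colourings (U - {u}). real (residual_size (U - {u}) \<tau> u) * g \<tau>)"
proof -
  have "(\<Sum>\<sigma>\<in>colourings U. g \<sigma>) =
      (\<Sum>p\<in>(SIGMA \<tau>:colourings (U - {u}). residual_list E L (U - {u}) \<tau> u).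
         g ((\<lambda>(\<tau>, c). \<tau>(u := c)) p))"
    using sum.reindex_bij_betw[OF bij_betw_extend_colouring[OF assms(2)], of g] by simp
  also have "\<dots> = (\<Sum>(\<tau>, c)\<in>(SIGMA \<tau>:colourings (U - {u}). residual_list E L (U - {u}) \<tau> u). g \<tau>)"
    by (intro sum.cong) (auto simp: g)
  also have "\<dots> = (\<Sum>\<tau>\<in>colourings (U - {u}). \<Sum>c\<in>residual_list E L (U - {u}) \<tau> u. g \<tau>)"
    using assms by (intro sum.Sigma[symmetric]) (auto intro!: finite_colourings finite_residual_list)
  finally show ?thesis by simp
qed

lemma card_colourings_extend:
  assumes "U \<subseteq> V" "u \<in> U"
  shows "real (card (colourings U)) =
    (\<Sum>\<tau>\<in>colourings (U - {u}). real (residual_size (U - {u}) \<tau> u))"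
  using sum_colourings_extend[OF assms, of "\<lambda>_. 1"] by simp

text \<open>A uniform colouring of \<open>U\<close> restricted to \<open>U - {u}\<close> is biased by the number of colours
  left for \<open>u\<close>; the weight \<open>1 / residual_size\<close> undoes this bias.\<close>

lemma sum_inverse_residual_size_le:
  assumes "U \<subseteq> V" "u \<in> U"
  shows "(\<Sum>\<sigma>\<in>colourings U. 1 / real (residual_size (U - {u}) \<sigma> u))
    \<le> real (card (colourings (U - {u})))"
proof -
  have "residual_list E L (U - {u}) (\<tau>(u := c)) u = residual_list E L (U - {u}) \<tau> u" for \<tau> c
    by (rule residual_list_cong) simp
  then have "(\<Sum>\<sigma>\<in>colourings U. 1 / real (residual_size (U - {u}) \<sigma> u)) =
      (\<Sum>\<tau>\<in>colourings (U - {u}). real (residual_size (U - {u}) \<tau> u) *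
         (1 / real (residual_size (U - {u}) \<tau> u)))"
    by (intro sum_colourings_extend assms) simp
  \<comment> \<open>Each term is 1, or 0 when no colour is left for \<open>u\<close>, since
    \<open>1 / 0 = 0\<close>.\<close>
  also have "\<dots> \<le> (\<Sum>\<tau>\<in>colourings (U - {u}). 1)"
    by (intro sum_mono) simp
  finally show ?thesis by simp
qed

section \<open>Expected number of colours left at a vertex\<close>

text \<open>Vertices of \<open>B\<close> have short lists: they are charged one colour of \<open>L v\<close> each, at price
  \<open>1 + a\<close>. For the others, the probability of avoiding \<open>c\<close> is at least an exponential, which
  the tangent line at \<open>a\<close> makes linear, so no concentration argument is needed.\<close>

lemma sum_residual_size_given_outside_ge:
  fixes a :: real and \<tau> :: "'v \<Rightarrow> nat"
  assumes "U \<subseteq> V" "v \<in> V" "0 \<le> a"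
  defines "N \<equiv> nbhd E v \<inter> U"
  defines "R \<equiv> U - N"
  defines "T \<equiv> {\<sigma>\<in>colourings U. restrict \<sigma> R = \<tau>}"
  defines "M \<equiv> \<lambda>u. real (residual_size R \<tau> u)"
  defines "D \<equiv> \<lambda>u. real (card (nbhd E u \<inter> N))"
  shows "exp (- a) * ((1 + a) * real (card (L v)) - real (card N)
        - (1 + a) * (\<Sum>u\<in>N. (D u + 1) / M u)) * real (card T)
    \<le> (\<Sum>\<sigma>\<in>T. real (residual_size U \<sigma> v))"
proof (cases "T = {}")
  case True
  then show ?thesis by simp
next
  case False
  have fin: "finite T" "finite N" "finite (L v)"
    using assms(1,2) finite_colourings finite_nbhd finite_L by (auto simp: T_def N_def)
  have N_V: "N \<subseteq> V"
    using assms(1) by (auto simp: N_def)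
  have D_nonneg: "0 \<le> D u" for u by (simp add: D_def)
  have in_list: "\<sigma> u \<in> residual_list E L R \<tau> u" if "\<sigma> \<in> T" "u \<in> N" for \<sigma> u
  proof -
    have "\<sigma> u \<in> residual_list E L (U - {u}) \<sigma> u"
      using that by (intro colour_in_residual_list) (auto simp: T_def N_def)
    moreover have "residual_list E L R \<tau> u = residual_list E L R \<sigma> u"
      using that by (intro residual_list_cong) (auto simp: T_def)
    moreover have "R \<subseteq> U - {u}"
      using that by (auto simp: R_def)
    ultimately show ?thesis by (auto simp: residual_list_def)
  qed
  \<comment> \<open>Any colouring in \<open>T\<close> exhibits a colour left for \<open>u\<close>;
    the case \<open>T = {}\<close> was split off for this.\<close>
  have M_pos: "0 < M u" if "u \<in> N" for u
    using False in_list[OF _ that] that N_V finite_residual_list[of u R \<tau>]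
    by (fastforce simp: M_def card_gt_0_iff)
  \<comment> \<open>The threshold makes \<open>1 + (1 + a) * ((D u + 1) / M u)\<close> bound both
    charges in \<open>cost\<close>: on \<open>B\<close> it is at least \<open>1 + a\<close>, off
    \<open>B\<close> at least \<open>M u / (M u - D u - 1)\<close>.\<close>
  define B where "B = {u\<in>N. a * M u \<le> (1 + a) * (D u + 1)}"
  define A where "A = N - B"
  have AB: "N = A \<union> B" "A \<inter> B = {}" "finite A" "finite B"
    using fin by (auto simp: A_def B_def)
  have A_gap: "D u + 1 < M u" if "u \<in> A" for u
  proof (rule ccontr)
    assume "\<not> D u + 1 < M u"
    then have "a * M u \<le> a * (D u + 1)"
      using \<open>0 \<le> a\<close> by (intro mult_left_mono) auto
    also have "\<dots> \<le> (1 + a) * (D u + 1)"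
      using D_nonneg[of u] by (intro mult_right_mono) auto
    finally show False
      using that by (auto simp: A_def B_def)
  qed
  define y where "y = (\<lambda>c u. if c \<in> residual_list E L R \<tau> u then 1 / (M u - D u - 1) else 0)"
  define avoid where "avoid = (\<lambda>c X. {\<sigma>\<in>T. c \<notin> \<sigma> ` X})"
  have fin_avoid: "finite (avoid c X)" for c X
    using fin by (simp add: avoid_def)
  have y_nonneg: "0 \<le> y c u" if "u \<in> A" for c u
    using A_gap[OF that] by (simp add: y_def)

  \<comment> \<open>Chain rule: vertices of \<open>A\<close> are added one at a time. Among the
    colourings avoiding \<open>c\<close> on \<open>B \<union> F\<close>, a fraction of at least
    \<open>exp (- y c u)\<close> avoids it at \<open>u\<close> too.\<close>
  have avoid_ge: "exp (- (\<Sum>u\<in>F. y c u)) * real (card (avoid c B)) \<le> real (card (avoid c (B \<union> F)))"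
    if "finite F" "F \<subseteq> A" for c F
    using that
  proof (induction F rule: finite_induct)
    case empty
    then show ?case by simp
  next
    case (insert u F)
    let ?T = "avoid c (B \<union> F)" and ?S = "{\<sigma>\<in>avoid c (B \<union> F). \<sigma> u = c}"
    have u: "u \<in> A" "u \<in> N" "u \<in> U" "u \<notin> B" "u \<in> V"
      using insert.prems AB N_V by (auto simp: N_def)
    have "avoid c (B \<union> insert u F) = ?T - ?S"
      by (auto simp: avoid_def)
    then have card_eq: "real (card (avoid c (B \<union> insert u F))) = real (card ?T) - real (card ?S)"
      using fin_avoid[of c "B \<union> F"] by (subst of_nat_diff[symmetric]) (auto simp: card_Diff_subset intro!: card_mono)
    have "exp (- y c u) * real (card ?T) \<le> real (card ?T) - real (card ?S)"
    proof (cases "c \<in> residual_list E L R \<tau> u")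
      case False
      then have "?S = {}"
        using in_list[OF _ u(2)] by (auto simp: avoid_def)
      then have "card ?S = 0" by (simp only: card.empty)
      then show ?thesis
        using False by (simp add: y_def)
    next
      case True
      define m where "m = M u - D u"
      have m: "1 < m" using A_gap[OF u(1)] by (simp add: m_def)
      have "m * real (card ?S) \<le> real (card ?T)"
      \<comment> \<open>Recolouring \<open>u\<close> preserves the restriction to \<open>R\<close>
        and the avoidance on \<open>B \<union> F\<close>. Neighbours of \<open>u\<close> inside
        \<open>N\<close> block at most \<open>D u\<close> of its \<open>M u\<close> colours.\<close>
      proof (rule card_value_le_switching[OF fin_avoid])
        fix \<sigma> assume \<sigma>: "\<sigma> \<in> ?T" "\<sigma> u = c"
        let ?A = "residual_list E L (U - {u}) \<sigma> u"
        have "residual_list E L R \<tau> u = residual_list E L R \<sigma> u"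
          using \<sigma>(1) by (intro residual_list_cong) (auto simp: avoid_def T_def)
        then have "residual_list E L R \<tau> u - \<sigma> ` (nbhd E u \<inter> N) \<subseteq> ?A"
          by (auto simp: residual_list_def R_def)
        then have "card (residual_list E L R \<tau> u - \<sigma> ` (nbhd E u \<inter> N)) \<le> card ?A"
          using u by (intro card_mono finite_residual_list)
        moreover have "residual_size R \<tau> u - card (\<sigma> ` (nbhd E u \<inter> N))
            \<le> card (residual_list E L R \<tau> u - \<sigma> ` (nbhd E u \<inter> N))"
          using finite_nbhd by (intro diff_card_le_card_Diff) auto
        moreover have "card (\<sigma> ` (nbhd E u \<inter> N)) \<le> card (nbhd E u \<inter> N)"
          using finite_nbhd by (intro card_image_le) auto
        ultimately have "m \<le> real (card ?A)"
          by (simp add: m_def M_def D_def)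
        moreover have "\<sigma>(u := b) \<in> ?T" if "b \<in> ?A" for b
        proof -
          have "\<sigma>(u := b) \<in> colourings U"
            using \<sigma> u that by (intro recolour) (auto simp: avoid_def T_def)
          moreover have "restrict (\<sigma>(u := b)) R = restrict \<sigma> R"
            using u by (auto simp: R_def restrict_def fun_eq_iff)
          moreover have "(\<sigma>(u := b)) ` (B \<union> F) = \<sigma> ` (B \<union> F)"
            using u insert.hyps by (intro image_cong) auto
          ultimately show ?thesis
            using \<sigma> by (simp add: avoid_def T_def)
        qed
        ultimately show "\<exists>A. finite A \<and> m \<le> real (card A) \<and> (\<forall>b\<in>A. \<sigma>(u := b) \<in> ?T)"
          using finite_residual_list[OF u(5)] by blast
      qed
      then have "real (card ?S) \<le> real (card ?T) / m"
        using m by (simp add: field_simps)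
      moreover have "exp (- y c u) * real (card ?T) \<le> (1 - 1 / m) * real (card ?T)"
        using one_minus_inverse_ge_exp[OF m] True
        by (intro mult_right_mono) (auto simp: y_def m_def)
      ultimately show ?thesis by (simp add: algebra_simps)
    qed
    moreover have "exp (- (\<Sum>u\<in>insert u F. y c u)) * real (card (avoid c B))
        = exp (- y c u) * (exp (- (\<Sum>u\<in>F. y c u)) * real (card (avoid c B)))"
      using insert.hyps by (simp add: exp_add[symmetric])
    moreover have "\<dots> \<le> exp (- y c u) * real (card ?T)"
      using insert by (intro mult_left_mono) auto
    ultimately show ?case
      using card_eq by linarith
  qed

  have count: "(\<Sum>\<sigma>\<in>T. real (card (L v - \<sigma> ` X))) = (\<Sum>c\<in>L v. real (card (avoid c X)))" for X
  proof -
    have "(\<Sum>\<sigma>\<in>T. real (card (L v - \<sigma> ` X))) = (\<Sum>\<sigma>\<in>T. \<Sum>c\<in>L v. of_bool (c \<notin> \<sigma> ` X))"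
      using fin by (intro sum.cong refl) (simp add: set_diff_eq Int_def)
    also have "\<dots> = (\<Sum>c\<in>L v. \<Sum>\<sigma>\<in>T. of_bool (c \<notin> \<sigma> ` X))"
      by (rule sum.swap)
    also have "\<dots> = (\<Sum>c\<in>L v. real (card (avoid c X)))"
      using fin by (intro sum.cong refl) (simp add: avoid_def Int_def)
    finally show ?thesis .
  qed

  define Y where "Y = (\<lambda>c. \<Sum>u\<in>A. y c u)"
  have Y_nonneg: "0 \<le> Y c" for c
    using y_nonneg by (simp add: Y_def sum_nonneg)
  have sum_Y: "(\<Sum>c\<in>L v. Y c) \<le> (\<Sum>u\<in>A. M u / (M u - D u - 1))"
  proof -
    have "(\<Sum>c\<in>L v. Y c) = (\<Sum>u\<in>A. \<Sum>c\<in>L v. y c u)"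
      unfolding Y_def by (rule sum.swap)
    also have "\<dots> \<le> (\<Sum>u\<in>A. M u / (M u - D u - 1))"
    proof (rule sum_mono)
      fix u assume u: "u \<in> A"
      have "(\<Sum>c\<in>L v. y c u)
          = real (card (L v \<inter> residual_list E L R \<tau> u)) * (1 / (M u - D u - 1))"
        using fin by (simp add: y_def sum.If_cases Int_def)
      also have "\<dots> \<le> M u * (1 / (M u - D u - 1))"
        using A_gap[OF u] u AB N_V finite_residual_list[of u R \<tau>]
        by (intro mult_right_mono) (auto simp: M_def intro!: card_mono)
      finally show "(\<Sum>c\<in>L v. y c u) \<le> M u / (M u - D u - 1)" by simp
    qed
    finally show ?thesis .
  qed
  have cost: "(1 + a) * real (card B) + (\<Sum>u\<in>A. M u / (M u - D u - 1))
      \<le> real (card N) + (1 + a) * (\<Sum>u\<in>N. (D u + 1) / M u)"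
  proof -
    have "(1 + a) * real (card B) = (\<Sum>u\<in>B. 1 + a)"
      by simp
    also have "\<dots> \<le> (\<Sum>u\<in>B. 1 + (1 + a) * ((D u + 1) / M u))"
    proof (rule sum_mono)
      fix u assume "u \<in> B"
      then show "1 + a \<le> 1 + (1 + a) * ((D u + 1) / M u)"
        using M_pos[of u] by (simp add: B_def field_simps)
    qed
    finally have 1: "(1 + a) * real (card B) \<le> (\<Sum>u\<in>B. 1 + (1 + a) * ((D u + 1) / M u))" .
    have 2: "(\<Sum>u\<in>A. M u / (M u - D u - 1)) \<le> (\<Sum>u\<in>A. 1 + (1 + a) * ((D u + 1) / M u))"
    proof (rule sum_mono)
      fix u assume u: "u \<in> A"
      define p where "p = D u + 1"
      have p: "0 < p" "p < M u" "0 < M u"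
        using D_nonneg[of u] A_gap[OF u] by (auto simp: p_def)
      have "(1 + a) * p < a * M u"
        using u by (auto simp: A_def B_def p_def)
      then have "M u \<le> (1 + a) * (M u - p)"
        by (simp add: algebra_simps)
      then have "1 / (M u - p) \<le> (1 + a) / M u"
        using p by (simp add: field_simps)
      then have "p * (1 / (M u - p)) \<le> p * ((1 + a) / M u)"
        using p by (intro mult_left_mono) auto
      moreover have "M u / (M u - p) = 1 + p * (1 / (M u - p))"
        using p by (simp add: field_simps)
      ultimately have "M u / (M u - p) \<le> 1 + (1 + a) * (p / M u)"
        by (simp add: mult.commute)
      then show "M u / (M u - D u - 1) \<le> 1 + (1 + a) * ((D u + 1) / M u)"
        by (simp add: p_def algebra_simps)
    qed
    have "(\<Sum>u\<in>A. 1 + (1 + a) * ((D u + 1) / M u)) + (\<Sum>u\<in>B. 1 + (1 + a) * ((D u + 1) / M u))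
        = (\<Sum>u\<in>N. 1 + (1 + a) * ((D u + 1) / M u))"
      unfolding AB(1) using AB by (simp only: sum.union_disjoint)
    also have "\<dots> = real (card N) + (1 + a) * (\<Sum>u\<in>N. (D u + 1) / M u)"
      by (simp add: sum.distrib sum_distrib_left)
    finally show ?thesis
      using 1 2 by linarith
  qed

  have "((1 + a) * real (card (L v)) - real (card N) - (1 + a) * (\<Sum>u\<in>N. (D u + 1) / M u))
        * real (card T)
      \<le> ((1 + a) * (real (card (L v)) - real (card B)) - (\<Sum>c\<in>L v. Y c)) * real (card T)"
    using cost sum_Y by (intro mult_right_mono) (auto simp: algebra_simps)
  also have "\<dots> = (1 + a) * (\<Sum>\<sigma>\<in>T. real (card (L v)) - real (card B))
      - (\<Sum>c\<in>L v. Y c * real (card T))"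
    by (simp add: algebra_simps sum_distrib_left)
  \<comment> \<open>Each vertex of \<open>B\<close> removes at most one colour. Since
    \<open>Y c\<close> is nonnegative, \<open>T\<close> may shrink to \<open>avoid c B\<close> in
    the second sum, so that both sums can be merged colour by colour.\<close>
  also have "\<dots> \<le> (1 + a) * (\<Sum>\<sigma>\<in>T. real (card (L v - \<sigma> ` B)))
      - (\<Sum>c\<in>L v. Y c * real (card (avoid c B)))"
  proof (intro diff_mono mult_left_mono sum_mono)
    fix \<sigma>
    have "card (L v) - card (\<sigma> ` B) \<le> card (L v - \<sigma> ` B)"
      using AB by (intro diff_card_le_card_Diff) auto
    moreover have "card (\<sigma> ` B) \<le> card B"
      using AB by (intro card_image_le)
    ultimately show "real (card (L v)) - real (card B) \<le> real (card (L v - \<sigma> ` B))"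
      by linarith
  next
    fix c
    show "real (card (avoid c B)) \<le> real (card T)"
      using fin by (intro of_nat_mono card_mono) (auto simp: avoid_def)
  qed (use Y_nonneg \<open>0 \<le> a\<close> in auto)
  also have "\<dots> = (\<Sum>c\<in>L v. (1 + a - Y c) * real (card (avoid c B)))"
    by (simp add: count sum_distrib_left algebra_simps sum.distrib sum_subtractf)
  also have "\<dots> \<le> (\<Sum>c\<in>L v. exp a * real (card (avoid c N)))"
  proof (rule sum_mono)
    fix c
    \<comment> \<open>The tangent line of \<open>exp (- z)\<close> at \<open>z = a\<close>, scaled
      by \<open>exp a\<close>. It stays valid when \<open>1 + a - Y c\<close> is negative, so
      heavily loaded colours need no separate case.\<close>
    have "1 + a - Y c \<le> exp (a - Y c)"
      using exp_ge_add_one_self[of "a - Y c"] by linarith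
    then have "(1 + a - Y c) * real (card (avoid c B)) \<le> exp (a - Y c) * real (card (avoid c B))"
      by (intro mult_right_mono) auto
    also have "\<dots> = exp a * (exp (- Y c) * real (card (avoid c B)))"
      by (simp add: exp_diff exp_minus field_simps)
    also have "\<dots> \<le> exp a * real (card (avoid c N))"
      using avoid_ge[OF AB(3) subset_refl, of c] AB(1)
      by (intro mult_left_mono) (auto simp: Y_def Un_commute)
    finally show "(1 + a - Y c) * real (card (avoid c B)) \<le> exp a * real (card (avoid c N))" .
  qed
  also have "\<dots> = exp a * (\<Sum>\<sigma>\<in>T. real (residual_size U \<sigma> v))"
    unfolding sum_distrib_left[symmetric] count[symmetric] residual_list_def N_def ..
  finally show ?thesis
    by (simp add: exp_minus field_simps)
qed

text \<open>Averages the conditional bound over the colouring outside \<open>N\<close>. There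
  \<open>1 / M\<close> enters linearly, so its mean suffices. As \<open>R\<close> lies in
  \<open>U - {u}\<close>, \<open>1 / M\<close> is at most the weight in
  \<open>sum_inverse_residual_size_le\<close>, whose mean is at most \<open>1 / l\<close> by
  \<open>IH\<close>.\<close>

lemma sum_residual_size_ge:
  fixes a l :: real
  assumes "U \<subseteq> V" "v \<in> V" "0 \<le> a" "0 < l"
    and IH: "\<And>u. u \<in> U \<Longrightarrow> l * real (card (colourings (U - {u}))) \<le> real (card (colourings U))"
  defines "N \<equiv> nbhd E v \<inter> U"
  shows "exp (- a) * ((1 + a) * real (card (L v)) - real (card N)
        - (1 + a) * (\<Sum>u\<in>N. real (card (nbhd E u \<inter> N)) + 1) / l) * real (card (colourings U))
    \<le> (\<Sum>\<sigma>\<in>colourings U. real (residual_size U \<sigma> v))"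
proof -
  define R where "R = U - N"
  define D where "D = (\<lambda>u. real (card (nbhd E u \<inter> N)) + 1)"
  define M where "M = (\<lambda>\<sigma> u. real (residual_size R \<sigma> u))"
  define K where "K = (1 + a) * real (card (L v)) - real (card N)"
  let ?C = "colourings U"
  have fin: "finite ?C" by (rule finite_colourings) fact
  have inverse_M: "(\<Sum>\<sigma>\<in>?C. 1 / M \<sigma> u) \<le> real (card ?C) / l" if u: "u \<in> N" for u
  proof -
    have uU: "u \<in> U" "u \<in> V" using u assms(1) by (auto simp: N_def)
    have "(\<Sum>\<sigma>\<in>?C. 1 / M \<sigma> u) \<le> (\<Sum>\<sigma>\<in>?C. 1 / real (residual_size (U - {u}) \<sigma> u))"
    proof (rule sum_mono)
      fix \<sigma> assume \<sigma>: "\<sigma> \<in> ?C"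
      have "0 < residual_size (U - {u}) \<sigma> u"
        using colour_in_residual_list[OF \<sigma> uU(1)] finite_residual_list[OF uU(2)]
        by (auto simp: card_gt_0_iff)
      moreover have "residual_size (U - {u}) \<sigma> u \<le> residual_size R \<sigma> u"
        using u by (intro card_mono finite_residual_list uU) (auto simp: residual_list_def R_def)
      ultimately show "1 / M \<sigma> u \<le> 1 / real (residual_size (U - {u}) \<sigma> u)"
        by (intro divide_left_mono) (auto simp: M_def)
    qed
    also have "\<dots> \<le> real (card (colourings (U - {u})))"
      by (rule sum_inverse_residual_size_le) fact+
    also have "\<dots> \<le> real (card ?C) / l"
      using IH[OF uU(1)] \<open>0 < l\<close> by (simp add: field_simps)
    finally show ?thesis .
  qed
  let ?h = "\<lambda>\<sigma>. exp (- a) * (K - (1 + a) * (\<Sum>u\<in>N. D u / M \<sigma> u))"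
  have "exp (- a) * (K - (1 + a) * (\<Sum>u\<in>N. D u) / l) * real (card ?C)
      = exp (- a) * (K * real (card ?C) - (1 + a) * (\<Sum>u\<in>N. D u * (real (card ?C) / l)))"
    by (simp add: algebra_simps sum_distrib_left sum_divide_distrib)
  also have "\<dots> \<le> exp (- a) * (K * real (card ?C) - (1 + a) * (\<Sum>u\<in>N. D u * (\<Sum>\<sigma>\<in>?C. 1 / M \<sigma> u)))"
    using inverse_M \<open>0 \<le> a\<close>
    by (intro mult_left_mono diff_mono sum_mono order_refl) (auto simp: D_def)
  also have "\<dots> = (\<Sum>\<sigma>\<in>?C. ?h \<sigma>)"
  proof -
    have "(\<Sum>u\<in>N. D u * (\<Sum>\<sigma>\<in>?C. 1 / M \<sigma> u)) = (\<Sum>\<sigma>\<in>?C. \<Sum>u\<in>N. D u / M \<sigma> u)"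
      by (subst sum.swap) (simp add: sum_distrib_left)
    then show ?thesis
      by (simp add: sum_subtractf sum_distrib_left[symmetric])
  qed
  \<comment> \<open>\<open>?h \<sigma>\<close> depends only on \<open>\<sigma>\<close> restricted to
    \<open>R\<close>, so it is constant on each fibre.\<close>
  also have "\<dots> = (\<Sum>\<tau>\<in>(\<lambda>\<sigma>. restrict \<sigma> R) ` ?C. \<Sum>\<sigma>\<in>{\<sigma>\<in>?C. restrict \<sigma> R = \<tau>}. ?h \<sigma>)"
    by (rule sum.image_gen[OF fin])
  also have "\<dots> \<le> (\<Sum>\<tau>\<in>(\<lambda>\<sigma>. restrict \<sigma> R) ` ?C.
      \<Sum>\<sigma>\<in>{\<sigma>\<in>?C. restrict \<sigma> R = \<tau>}. real (residual_size U \<sigma> v))"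
  proof (rule sum_mono)
    fix \<tau>
    let ?T = "{\<sigma>\<in>?C. restrict \<sigma> R = \<tau>}"
    have "(\<Sum>\<sigma>\<in>?T. ?h \<sigma>) = (\<Sum>\<sigma>\<in>?T. ?h \<tau>)"
    proof (rule sum.cong[OF refl])
      fix \<sigma> assume "\<sigma> \<in> ?T"
      then have "M \<sigma> u = M \<tau> u" for u
        unfolding M_def by (subst residual_list_cong[of R \<sigma> \<tau>]) auto
      then show "?h \<sigma> = ?h \<tau>" by simp
    qed
    also have "\<dots> = ?h \<tau> * real (card ?T)"
      by simp
    also have "\<dots> \<le> (\<Sum>\<sigma>\<in>?T. real (residual_size U \<sigma> v))"
      using sum_residual_size_given_outside_ge[OF assms(1-3), of \<tau>]
      unfolding K_def M_def D_def R_def N_def .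
    finally show "(\<Sum>\<sigma>\<in>?T. ?h \<sigma>) \<le> (\<Sum>\<sigma>\<in>?T. real (residual_size U \<sigma> v))" .
  qed
  also have "\<dots> = (\<Sum>\<sigma>\<in>?C. real (residual_size U \<sigma> v))"
    by (rule sum.image_gen[OF fin, symmetric])
  finally show ?thesis by (simp add: K_def D_def)
qed

section \<open>Induction on the vertex set\<close>

text \<open>Assumption \<open>lists\<close> says that the bound of
  \<open>sum_residual_size_ge\<close> is at least \<open>l\<close>, multiplied through by
  \<open>exp (a v)\<close>, with the whole neighbourhood in place of its part in the subgraph and
  \<open>sparse\<close> inserted.\<close>

theorem card_colourings_growth:
  fixes a :: "'v \<Rightarrow> real" and l s :: real
  assumes "0 < l"
    and a: "\<And>v. v \<in> V \<Longrightarrow> 0 \<le> a v"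
    and sparse: "\<And>v. v \<in> V \<Longrightarrow>
      (\<Sum>u\<in>nbhd E v. real (card (nbhd E u \<inter> nbhd E v)) + 1) \<le> s * real (vertex_degree E v)"
    and lists: "\<And>v. v \<in> V \<Longrightarrow> l * exp (a v) \<le> (1 + a v) * real (card (L v))
      - real (vertex_degree E v) * (1 + (1 + a v) * s / l)"
    and "U \<subseteq> V" "v \<in> U"
  shows "l * real (card (colourings (U - {v}))) \<le> real (card (colourings U))"
proof -
  have "finite U" using \<open>U \<subseteq> V\<close> finite_V by (rule finite_subset)
  then show ?thesis using \<open>U \<subseteq> V\<close> \<open>v \<in> U\<close>
  proof (induction U arbitrary: v rule: finite_psubset_induct)
    case (psubset U)
    let ?W = "U - {v}" and ?N = "nbhd E v \<inter> (U - {v})"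
    have v: "v \<in> V" "?W \<subseteq> V" "?W \<subset> U" using psubset.prems by auto
    have "(\<Sum>u\<in>?N. real (card (nbhd E u \<inter> ?N)) + 1)
        \<le> (\<Sum>u\<in>?N. real (card (nbhd E u \<inter> nbhd E v)) + 1)"
      by (intro sum_mono) (auto intro!: card_mono finite_nbhd finite_Int)
    also have "\<dots> \<le> (\<Sum>u\<in>nbhd E v. real (card (nbhd E u \<inter> nbhd E v)) + 1)"
      by (intro sum_mono2 finite_nbhd) auto
    also have "\<dots> \<le> s * real (vertex_degree E v)"
      by (rule sparse[OF v(1)])
    finally have "(1 + a v) * (\<Sum>u\<in>?N. real (card (nbhd E u \<inter> ?N)) + 1) / l
        \<le> (1 + a v) * (s * real (vertex_degree E v)) / l"
      using a[OF v(1)] \<open>0 < l\<close> by (intro divide_right_mono mult_left_mono) auto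
    moreover have "real (card ?N) \<le> real (vertex_degree E v)"
      by (auto simp: vertex_degree_def intro!: card_mono finite_nbhd)
    ultimately have "l * exp (a v) \<le> (1 + a v) * real (card (L v)) - real (card ?N)
        - (1 + a v) * (\<Sum>u\<in>?N. real (card (nbhd E u \<inter> ?N)) + 1) / l"
      using lists[OF v(1)] by (simp add: algebra_simps)
    then have "exp (- a v) * (l * exp (a v)) * real (card (colourings ?W))
        \<le> exp (- a v) * ((1 + a v) * real (card (L v)) - real (card ?N)
        - (1 + a v) * (\<Sum>u\<in>?N. real (card (nbhd E u \<inter> ?N)) + 1) / l) * real (card (colourings ?W))"
      by (intro mult_right_mono mult_left_mono) auto
    also have "\<dots> \<le> (\<Sum>\<sigma>\<in>colourings ?W. real (residual_size ?W \<sigma> v))"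
      \<comment> \<open>The induction hypothesis for \<open>?W\<close> covers the removal of any
        vertex of \<open>?W\<close>, hence all neighbours of \<open>v\<close> in it at once.\<close>
      using psubset.IH[OF v(3) v(2)]
      by (intro sum_residual_size_ge v a \<open>0 < l\<close>) auto
    also have "\<dots> = real (card (colourings U))"
      using psubset.prems by (intro card_colourings_extend[symmetric])
    finally show ?case
      by (simp add: exp_minus mult.left_commute[of _ l])
  qed
qed

text \<open>Starting from the empty colouring, growth by a positive factor keeps every count
  positive. This makes the uniform distribution meaningful.\<close>

lemma colourings_nonempty_of_growth:
  fixes l :: real
  assumes "0 < l"
    and growth: "\<And>U v. U \<subseteq> V \<Longrightarrow> v \<in> U \<Longrightarrow>
      l * real (card (colourings (U - {v}))) \<le> real (card (colourings U))"
    and "U \<subseteq> V"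
  shows "colourings U \<noteq> {}"
proof -
  have "finite U" using \<open>U \<subseteq> V\<close> finite_V by (rule finite_subset)
  then show ?thesis using \<open>U \<subseteq> V\<close>
  proof (induction U rule: finite_induct)
    case empty
    then show ?case by (simp add: proper_colourings_def induced_def)
  next
    case (insert v U)
    then have "0 < card (colourings U)"
      by (simp add: card_gt_0_iff finite_colourings)
    then have "0 < l * real (card (colourings U))"
      using \<open>0 < l\<close> by simp
    also have "\<dots> \<le> real (card (colourings (insert v U)))"
      using growth[of "insert v U" v] insert by simp
    finally show ?case by auto
  qed
qed

section \<open>Specialisation to the given sparsity and list sizes\<close>

lemma sum_card_nbhd_Int_le:
  assumes "average_degree (nbhd E v) (induced E (nbhd E v)) \<le> d"
  shows "(\<Sum>u\<in>nbhd E v. real (card (nbhd E u \<inter> nbhd E v)) + 1)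
    \<le> (d + 1) * real (vertex_degree E v)"
proof -
  have "vertex_degree (induced E (nbhd E v)) u = card (nbhd E u \<inter> nbhd E v)"
    if "u \<in> nbhd E v" for u
  proof -
    have "nbhd (induced E (nbhd E v)) u = nbhd E u \<inter> nbhd E v"
      using that by (auto simp: nbhd_def induced_def)
    then show ?thesis by (simp add: vertex_degree_def)
  qed
  then have "(\<Sum>u\<in>nbhd E v. real (card (nbhd E u \<inter> nbhd E v))) / real (card (nbhd E v)) \<le> d"
    using assms by (simp add: average_degree_def)
  then have "(\<Sum>u\<in>nbhd E v. real (card (nbhd E u \<inter> nbhd E v))) \<le> d * real (card (nbhd E v))"
    using finite_nbhd[of v] by (cases "nbhd E v = {}") (auto simp: field_simps card_gt_0_iff)
  then show ?thesis
    by (simp add: sum.distrib vertex_degree_def algebra_simps)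
qed

end

theorem theorem2p11:
  fixes V :: "'v set" and E :: "'v \<Rightarrow> 'v \<Rightarrow> bool"
    and \<Delta> :: nat and d \<rho> \<l> :: real and L :: "'v \<Rightarrow> nat set"
  assumes "finite V" and "simple_graph V E"
    and "max_degree V E = \<Delta>"
    and "\<forall>u\<in>V. average_degree (nbhd E u) (induced E (nbhd E u)) \<le> d"
    and "d \<le> real \<Delta> / 6 - 1"
    and "\<rho> = real \<Delta> / (d + 1)"
    and "\<l> \<ge> (d + 1) * (ln \<rho>) ^ 3"
    and "\<forall>v\<in>V. finite (L v)"
    and "\<forall>v\<in>V. real (card (L v)) \<ge>
           (1 + 2 / ln \<rho>) * div_Lambert_W (real (vertex_degree E v)) \<l>"
  shows "\<forall>v\<in>V.
           proper_colourings (V - {v}) (induced E (V - {v})) L \<noteq> {} \<and>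
           measure_pmf.expectation
             (pmf_of_set (proper_colourings (V - {v}) (induced E (V - {v})) L))
             (\<lambda>\<sigma>. real (card (residual_list E L (V - {v}) \<sigma> v))) \<ge> \<l>"
proof
  fix v assume "v \<in> V"
  interpret list_coloured_graph V E L
    using assms by unfold_locales auto
  \<comment> \<open>The existence of \<open>v\<close> forces \<open>0 \<le> d\<close>, so
    \<open>d + 1\<close> is positive and \<open>\<rho>\<close> is at least 6.\<close>
  have "0 \<le> average_degree (nbhd E v) (induced E (nbhd E v))"
    by (simp add: average_degree_def sum_nonneg)
  then have "0 \<le> d"
    using assms(4) \<open>v \<in> V\<close> by force
  then have "6 \<le> \<rho>"
    using assms(5,6) by (simp add: pos_le_divide_eq)
  define r where "r = ln \<rho>"
  have exp_r: "exp r = \<rho>"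
    using \<open>6 \<le> \<rho>\<close> by (simp add: r_def)
  have "exp 1 \<le> \<rho>"
    using exp_le \<open>6 \<le> \<rho>\<close> by linarith
  then have "1 \<le> r"
    using \<open>6 \<le> \<rho>\<close> by (simp add: r_def ln_ge_iff)
  have l_ge: "(d + 1) * r ^ 3 \<le> \<l>"
    using assms(7) by (simp add: r_def)
  have "0 < \<l>"
    using l_ge \<open>0 \<le> d\<close> \<open>1 \<le> r\<close> by (smt (verit) mult_pos_pos zero_less_power)
  \<comment> \<open>A list of size \<open>\<l> * exp (a w)\<close> has \<open>a w\<close> neighbours
    of \<open>w\<close> per colour, so \<open>a w\<close> is the typical load of a colour and the
    natural point of tangency.\<close>
  define a where "a = (\<lambda>w. Lambert_W (real (vertex_degree E w) / \<l>))"
  have a_nonneg: "0 \<le> a w" for w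
    using \<open>0 < \<l>\<close> by (simp add: a_def Lambert_W_nonneg)
  have deg_eq: "real (vertex_degree E w) = \<l> * a w * exp (a w)" for w
    using Lambert_W_times_exp[of "real (vertex_degree E w) / \<l>"] \<open>0 < \<l>\<close>
    by (simp add: a_def field_simps)
  \<comment> \<open>As \<open>\<rho> = exp r\<close>, the degree is at most
    \<open>(d + 1) * exp r\<close>; the factor \<open>r ^ 4\<close>, at least 1, is inserted to
    reach \<open>\<l> * (r * exp r)\<close>.\<close>
  have a_le: "a w \<le> r" if "w \<in> V" for w
    unfolding a_def
  proof (rule Lambert_W_le_of_le)
    have "vertex_degree E w \<le> \<Delta>"
      using assms(1,3) that by (auto simp: max_degree_def)
    then have "real (vertex_degree E w) \<le> (d + 1) * \<rho>"
      using assms(6) \<open>0 \<le> d\<close> by simp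
    also have "\<dots> \<le> (d + 1) * (r ^ 4 * \<rho>)"
      using \<open>1 \<le> r\<close> \<open>0 \<le> d\<close> \<open>6 \<le> \<rho>\<close> by (intro mult_left_mono) auto
    also have "\<dots> = (d + 1) * r ^ 3 * (r * exp r)"
      by (simp add: exp_r power_numeral_reduce)
    also have "\<dots> \<le> \<l> * (r * exp r)"
      using l_ge \<open>1 \<le> r\<close> by (intro mult_right_mono) auto
    finally show "real (vertex_degree E w) / \<l> \<le> r * exp r"
      using \<open>0 < \<l>\<close> by (simp add: field_simps)
  qed (use \<open>1 \<le> r\<close> \<open>0 < \<l>\<close> in auto)
  have growth: "\<l> * real (card (colourings (U - {w}))) \<le> real (card (colourings U))"
    if "U \<subseteq> V" "w \<in> U" for U w
  proof (rule card_colourings_growth[where s = "d + 1" and a = a])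
    fix w assume w: "w \<in> V"
    show "(\<Sum>u\<in>nbhd E w. real (card (nbhd E u \<inter> nbhd E w)) + 1) \<le> (d + 1) * real (vertex_degree E w)"
      using assms(4) w by (intro sum_card_nbhd_Int_le) auto
    \<comment> \<open>The surplus factor \<open>1 + 2 / r\<close> in the list size has to pay for
      the local density, of relative cost \<open>a w * ((d + 1) / \<l>)\<close>.\<close>
    have "(d + 1) * a w * r \<le> (d + 1) * r ^ 3"
    proof -
      have "a w * r \<le> r * r" using a_le[OF w] \<open>1 \<le> r\<close> by (intro mult_right_mono) auto
      also have "\<dots> \<le> r ^ 3" using power_increasing[of 2 3 r] \<open>1 \<le> r\<close> by (simp add: power2_eq_square)
      finally show ?thesis using \<open>0 \<le> d\<close> by (simp add: mult.assoc mult_left_mono)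
    qed
    also have "\<dots> \<le> 2 * \<l>" using l_ge \<open>0 < \<l>\<close> by linarith
    finally have slack: "a w * ((d + 1) / \<l>) \<le> 2 / r"
      using \<open>1 \<le> r\<close> \<open>0 < \<l>\<close> by (simp add: field_simps)
    have "(1 + 2 / r) * (\<l> * exp (a w)) \<le> real (card (L w))"
      using assms(9) w div_Lambert_W_eq[of "real (vertex_degree E w)" \<l>] \<open>0 < \<l>\<close>
      by (force simp: a_def r_def)
    then have "(1 + a w) * ((1 + 2 / r) * (\<l> * exp (a w))) \<le> (1 + a w) * real (card (L w))"
      using a_nonneg by (intro mult_left_mono) (auto intro: add_nonneg_nonneg)
    moreover have "\<l> * exp (a w) * (1 + a w) * (a w * ((d + 1) / \<l>))
        \<le> \<l> * exp (a w) * (1 + a w) * (2 / r)"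
      using slack a_nonneg[of w] \<open>0 < \<l>\<close> by (intro mult_left_mono) auto
    \<comment> \<open>The main terms cancel: \<open>(1 + a w) * \<l> * exp (a w)\<close> minus the
      degree \<open>\<l> * a w * exp (a w)\<close> is exactly the required
      \<open>\<l> * exp (a w)\<close>. Only the surplus and the density cost remain, with a common
      factor.\<close>
    moreover have "(1 + a w) * ((1 + 2 / r) * (\<l> * exp (a w)))
        - \<l> * a w * exp (a w) * (1 + (1 + a w) * (d + 1) / \<l>) - \<l> * exp (a w)
      = \<l> * exp (a w) * (1 + a w) * (2 / r) - \<l> * exp (a w) * (1 + a w) * (a w * ((d + 1) / \<l>))"
    proof -
      define q where "q = (d + 1) / \<l>"
      define e where "e = 2 / r"
      have "(1 + a w) * (d + 1) / \<l> = (1 + a w) * q" by (simp add: q_def)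
      then show ?thesis
        unfolding q_def[symmetric] e_def[symmetric] by (simp add: algebra_simps)
    qed
    ultimately show "\<l> * exp (a w) \<le> (1 + a w) * real (card (L w))
        - real (vertex_degree E w) * (1 + (1 + a w) * (d + 1) / \<l>)"
      unfolding deg_eq by linarith
  qed (use that \<open>0 < \<l>\<close> \<open>0 \<le> d\<close> a_nonneg in auto)
  let ?C = "colourings (V - {v})"
  have nonempty: "?C \<noteq> {}"
    using \<open>0 < \<l>\<close> growth by (rule colourings_nonempty_of_growth) auto
  have fin: "finite ?C"
    by (rule finite_colourings) auto
  then have "0 < real (card ?C)"
    using nonempty by (simp add: card_gt_0_iff)
  then have "\<l> \<le> real (card (colourings V)) / real (card ?C)"
    using growth[of V v] \<open>v \<in> V\<close> by (simp add: field_simps)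
  also have "\<dots> = measure_pmf.expectation (pmf_of_set ?C) (\<lambda>\<sigma>. real (residual_size (V - {v}) \<sigma> v))"
    using card_colourings_extend[of V v] \<open>v \<in> V\<close>
    by (simp add: integral_pmf_of_set[OF nonempty fin])
  finally show "?C \<noteq> {} \<and>
      measure_pmf.expectation (pmf_of_set ?C) (\<lambda>\<sigma>. real (residual_size (V - {v}) \<sigma> v)) \<ge> \<l>"
    using nonempty by simp
qed

end
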